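(* Let $\mathbb{T}$ be a time scale with $\sup\mathbb{T}=\infty$, $t_0\in\mathbb{T}$, let $A:[t_0,\infty)_{\mathbb{T}}\to[0,\infty)$ and $\alpha:[t_0,\infty)_{\mathbb{T}}\to\mathbb{T}$ be rd-continuous with $\lim_{t\to\infty}\alpha(t)=\infty$, and consider the delay dynamic equation $$x^{\Delta}(t)+A(t)x(\alpha(t))=0,\qquad t\in[t_0,\infty)_{\mathbb{T}}. \quad (E)$$ Assume that $\alpha(t)\le t$ for all $t\in[t_0,\infty)_{\mathbb{T}}$, and that $$\sup_{s\in[t_0,\infty)_{\mathbb{T}}}\int_s^{\alpha_{-1}(s)}A(\eta)\,\Delta\eta<\infty ,\qquad \sup_{t\in[t_0,\infty)_{\mathbb{T}}}\int_{\alpha_*(t)}^{\sigma(t)}A(\eta)\,\Delta\eta<1,\qquad \int_{t_0}^{\infty}A(\eta)\,\Delta\eta=\infty .$$ Then the trivial solution of (E) is globally asymptotically stable.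
   Context: Time scales: a time scale $\mathbb{T}$ is a nonempty closed subset of $\mathbb{R}$; an interval with subscript $\mathbb{T}$ means its intersection with $\mathbb{T}$. $\sigma(t)=\inf(t,\infty)_{\mathbb{T}}$, $\mu(t)=\sigma(t)-t$; $t$ is right-dense if $\mu(t)=0$, right-scattered otherwise; left-dense and left-scattered points are defined similarly with $\rho(t)=\sup(-\infty,t)_{\mathbb{T}}$. $f^{\Delta}(t)$ is the $\Delta$-derivative: the number such that for every $\varepsilon>0$ there is a neighbourhood $U$ of $t$ in $\mathbb T$ with $|f(\sigma(t))-f(r)-f^{\Delta}(t)(\sigma(t)-r)|\le\varepsilon|\sigma(t)-r|$ for all $r\in U$. A function is rd-continuous if it is continuous at right-dense points and has finite limits at left-dense points. The $\Delta$-integral of an rd-continuous $f$ is $\int_s^t f(\eta)\Delta\eta=F(t)-F(s)$ with $F^{\Delta}=f$. Delay functions: $\alpha_*(t):=\inf\{\alpha(\eta):\eta\in[t,\infty)_{\mathbb{T}}\}$ and $\alpha_{-1}(t):=\sup\{\eta\in[t_0,\infty)_{\mathbb{T}}:\alpha_*(\eta)\le t\}$ for $t\in[t_0,\infty)_{\mathbb T}$. Initial value problem: for $s\in[t_0,\infty)_{\mathbb{T}}$, a solution of (E) with data $(s,x_0,\varphi)$ is a function $x:[\alpha_*(s),\infty)_{\mathbb{T}}\to\mathbb{R}$ that is rd-continuous on $[\alpha_*(s),s]_{\mathbb{T}}$, is $\Delta$-differentiable on $[s,\infty)_{\mathbb{T}}$ with an rd-continuous derivative, satisfies $x^{\Delta}(t)+A(t)x(\alpha(t))=0$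 identically on $[s,\infty)_{\mathbb{T}}$, and has $x(s)=x_0$ and $x(t)=\varphi(t)$ for $t\in[\alpha_*(s),s)_{\mathbb{T}}$. Stability notions for the trivial solution. Uniformly stable: for every $\varepsilon>0$ there is $\delta>0$ such that for every $s\in[t_0,\infty)_{\mathbb{T}}$, every solution $x$ with data $(s,x_0,\varphi)$ satisfying $|x_0|+\sup_{\eta\in[\alpha_*(s),s)_{\mathbb{T}}}|\varphi(\eta)|<\delta$ satisfies $|x(t)|<\varepsilon$ for all $t\in[s,\infty)_{\mathbb{T}}$. Globally attracting: for every $s\in[t_0,\infty)_{\mathbb T}$, every solution with data $(s,x_0,\varphi)$ satisfies $\lim_{t\to\infty}x(t)=0$. Globally asymptotically stable: uniformly stable and globally attracting. *)

theory Defs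
  imports Complex_Main "HOL-Library.Extended_Real"
begin

section \<open>Time scales\<close>

definition time_scale :: "real set \<Rightarrow> bool" where
  "time_scale T \<longleftrightarrow> closed T \<and> T \<noteq> {}"

text \<open>All notions take the time scale as an argument, so that an interval of a time scale,
  for instance \<open>T \<inter> {s..}\<close>, can serve as a time scale in its own right: derivatives and limits at
  \<open>s\<close> then involve only points of that interval. As usual, a maximum of the time scale is
  its own forward jump without being right-dense, and dually for a minimum.\<close>

definition fwd_jump :: "real set \<Rightarrow> real \<Rightarrow> real" where
  "fwd_jump T t = (if T \<inter> {t<..} = {} then t else Inf (T \<inter> {t<..}))"

definition bwd_jump :: "real set \<Rightarrow> real \<Rightarrow> real" where
  "bwd_jump T t = (if T \<inter> {..<t} = {} then t else Sup (T \<inter> {..<t}))"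

definition graininess :: "real set \<Rightarrow> real \<Rightarrow> real" where
  "graininess T t = fwd_jump T t - t"

definition right_dense :: "real set \<Rightarrow> real \<Rightarrow> bool" where
  "right_dense T t \<longleftrightarrow> T \<inter> {t<..} \<noteq> {} \<and> graininess T t = 0"

definition left_dense :: "real set \<Rightarrow> real \<Rightarrow> bool" where
  "left_dense T t \<longleftrightarrow> T \<inter> {..<t} \<noteq> {} \<and> bwd_jump T t = t"

definition rd_continuous_on :: "real set \<Rightarrow> (real \<Rightarrow> real) \<Rightarrow> bool" where
  "rd_continuous_on T f \<longleftrightarrow>
     (\<forall>t\<in>T. (right_dense T t \<longrightarrow> continuous (at t within T) f) \<and>
            (left_dense T t \<longrightarrow> (\<exists>l. (f \<longlongrightarrow> l) (at t within T \<inter> {..<t}))))"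

definition has_delta_deriv :: "real set \<Rightarrow> (real \<Rightarrow> real) \<Rightarrow> real \<Rightarrow> real \<Rightarrow> bool" where
  "has_delta_deriv T f D t \<longleftrightarrow>
     (\<forall>\<epsilon>>0. \<exists>d>0. \<forall>r\<in>T. \<bar>r - t\<bar> < d \<longrightarrow>
        \<bar>f (fwd_jump T t) - f r - D * (fwd_jump T t - r)\<bar> \<le> \<epsilon> * \<bar>fwd_jump T t - r\<bar>)"

definition delta_antideriv :: "real set \<Rightarrow> (real \<Rightarrow> real) \<Rightarrow> (real \<Rightarrow> real) \<Rightarrow> bool" where
  "delta_antideriv T f F \<longleftrightarrow> (\<forall>t\<in>T. has_delta_deriv T F (f t) t)"

text \<open>Meaningful for \<open>f\<close> rd-continuous on \<open>T\<close> and \<open>s, t \<in> T\<close>: an antiderivative on \<open>T\<close> then exists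
  and the difference does not depend on the one chosen.\<close>

definition delta_integral :: "real set \<Rightarrow> (real \<Rightarrow> real) \<Rightarrow> real \<Rightarrow> real \<Rightarrow> real" where
  "delta_integral T f s t = (let F = (SOME F. delta_antideriv T f F) in F t - F s)"

definition at_top_in :: "real set \<Rightarrow> real filter" where
  "at_top_in T = inf at_top (principal T)"


section \<open>Delay dynamic equations\<close>

definition delay_star :: "real set \<Rightarrow> (real \<Rightarrow> real) \<Rightarrow> real \<Rightarrow> real \<Rightarrow> real" where
  "delay_star T \<alpha> t0 t = Inf (\<alpha> ` (T \<inter> {t0..} \<inter> {t..}))"

definition delay_inv :: "real set \<Rightarrow> (real \<Rightarrow> real) \<Rightarrow> real \<Rightarrow> real \<Rightarrow> real" where
  "delay_inv T \<alpha> t0 t = Sup {\<eta> \<in> T \<inter> {t0..}. delay_star T \<alpha> t0 \<eta> \<le> t}"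

text \<open>Solutions of \<open>x\<^sup>\<Delta>(t) + A(t) x(\<alpha>(t)) = 0\<close> with data \<open>(s, x0, \<phi>)\<close>. Functions are total; only
  the values of \<open>x\<close> on \<open>T \<inter> {delay_star T \<alpha> t0 s..}\<close> and of \<open>\<phi>\<close> on
  \<open>T \<inter> {delay_star T \<alpha> t0 s..<s}\<close> matter. The derivative at \<open>s\<close> is taken in \<open>T \<inter> {s..}\<close>, and
  rd-continuity of the history in \<open>T \<inter> {delay_star T \<alpha> t0 s..s}\<close>, so \<open>x0\<close> need not be the left
  limit of \<open>\<phi>\<close> at \<open>s\<close>.\<close>

definition is_solution ::
  "real set \<Rightarrow> (real \<Rightarrow> real) \<Rightarrow> (real \<Rightarrow> real) \<Rightarrow> real \<Rightarrow>
   real \<Rightarrow> real \<Rightarrow> (real \<Rightarrow> real) \<Rightarrow> (real \<Rightarrow> real) \<Rightarrow> bool" where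
  "is_solution T A \<alpha> t0 s x0 \<phi> x \<longleftrightarrow>
     rd_continuous_on (T \<inter> {delay_star T \<alpha> t0 s..s}) x \<and>
     (\<exists>x'. rd_continuous_on (T \<inter> {s..}) x' \<and>
           (\<forall>t \<in> T \<inter> {s..}. has_delta_deriv (T \<inter> {s..}) x (x' t) t \<and>
                              x' t + A t * x (\<alpha> t) = 0)) \<and>
     x s = x0 \<and>
     (\<forall>t \<in> T \<inter> {delay_star T \<alpha> t0 s..<s}. x t = \<phi> t)"

text \<open>In \<open>ereal\<close> the supremum over the empty set is \<open>-\<infinity>\<close>; the \<open>max 0\<close> makes the history
  contribute \<open>0\<close> when \<open>T \<inter> {delay_star T \<alpha> t0 s..<s}\<close> is empty and changes nothing
  otherwise.\<close>

definition uniformly_stable ::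
  "real set \<Rightarrow> (real \<Rightarrow> real) \<Rightarrow> (real \<Rightarrow> real) \<Rightarrow> real \<Rightarrow> bool" where
  "uniformly_stable T A \<alpha> t0 \<longleftrightarrow>
     (\<forall>\<epsilon>>0. \<exists>\<delta>>0. \<forall>s \<in> T \<inter> {t0..}. \<forall>x0 \<phi> x.
        is_solution T A \<alpha> t0 s x0 \<phi> x \<longrightarrow>
        ereal \<bar>x0\<bar> + max 0 (SUP \<eta>\<in>T \<inter> {delay_star T \<alpha> t0 s..<s}. ereal \<bar>\<phi> \<eta>\<bar>) < ereal \<delta> \<longrightarrow>
        (\<forall>t \<in> T \<inter> {s..}. \<bar>x t\<bar> < \<epsilon>))"

definition globally_attracting ::
  "real set \<Rightarrow> (real \<Rightarrow> real) \<Rightarrow> (real \<Rightarrow> real) \<Rightarrow> real \<Rightarrow> bool" where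
  "globally_attracting T A \<alpha> t0 \<longleftrightarrow>
     (\<forall>s \<in> T \<inter> {t0..}. \<forall>x0 \<phi> x.
        is_solution T A \<alpha> t0 s x0 \<phi> x \<longrightarrow> (x \<longlongrightarrow> 0) (at_top_in T))"

definition globally_asymptotically_stable ::
  "real set \<Rightarrow> (real \<Rightarrow> real) \<Rightarrow> (real \<Rightarrow> real) \<Rightarrow> real \<Rightarrow> bool" where
  "globally_asymptotically_stable T A \<alpha> t0 \<longleftrightarrow>
     uniformly_stable T A \<alpha> t0 \<and> globally_attracting T A \<alpha> t0"

text \<open>The integral of \<open>A\<close> over \<open>[\<alpha>\<^sub>*(t), \<sigma>(t))\<close>. The lower limit can lie to the left of
  \<open>t0\<close>, where the coefficient \<open>A\<close> is not defined; that part contributes nothing.\<close>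

definition delay_integral :: "real set \<Rightarrow> (real \<Rightarrow> real) \<Rightarrow> (real \<Rightarrow> real) \<Rightarrow> real \<Rightarrow> real \<Rightarrow> real" where
  "delay_integral T A \<alpha> t0 t =
     delta_integral (T \<inter> {t0..}) A (max t0 (delay_star T \<alpha> t0 t)) (fwd_jump T t)"

end

theory Submission
  imports Defs "HOL-Analysis.Henstock_Kurzweil_Integration"
begin

text \<open>Let \<open>F\<close> be an antiderivative of \<open>A\<close> and \<open>l < 1\<close> bound the increments \<open>F(\<sigma>(t)) - F(u)\<close> with
  \<open>\<alpha>(t) \<le> u\<close>. A solution \<open>x\<close> can only increase at a point \<open>t\<close> with \<open>x(\<alpha>(t)) < 0\<close>, and then
  \<open>x(\<sigma>(t)) \<le> x(\<alpha>(t)) + K * l < K * l\<close> if \<open>\<bar>x\<bar> \<le> K\<close> at all arguments involved. With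
  data of size \<open>N\<close>, the case \<open>\<alpha>(t)\<close> before the initial time costs at most another \<open>N\<close>, so that
  \<open>\<bar>x\<bar> \<le> N + K * l\<close> with \<open>K\<close> the running maximum, hence \<open>\<bar>x\<bar> \<le> N / (1 - l)\<close>. If \<open>x \<circ> \<alpha>\<close> keeps
  changing sign, an eventual bound \<open>K\<close> on \<open>\<bar>x\<bar>\<close> improves to \<open>K * l\<close>, and by iteration \<open>x\<close> tends to \<open>0\<close>;
  otherwise \<open>x\<close> is eventually monotone and tends to \<open>0\<close> because \<open>F\<close> is unbounded.\<close>

section \<open>Jumps and delta derivatives\<close>

lemma fwd_jump_ge: "t \<le> fwd_jump T t"
  unfolding fwd_jump_def by (auto intro!: cInf_greatest)

lemma fwd_jump_le:
  assumes "r \<in> T" "t < r"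
  shows "fwd_jump T t \<le> r"
proof -
  have "bdd_below (T \<inter> {t<..})" by (rule bdd_belowI[of _ t]) auto
  then show ?thesis using assms unfolding fwd_jump_def by (auto intro!: cInf_lower)
qed

lemma fwd_jump_in:
  assumes "closed T" "t \<in> T"
  shows "fwd_jump T t \<in> T"
proof (cases "T \<inter> {t<..} = {}")
  case False
  have "bdd_below (T \<inter> {t<..})" by (rule bdd_belowI[of _ t]) auto
  with False have "Inf (T \<inter> {t<..}) \<in> closure (T \<inter> {t<..})"
    by (rule closure_contains_Inf)
  also have "\<dots> \<subseteq> T" using assms(1) by (simp add: closure_minimal)
  finally show ?thesis using False by (simp add: fwd_jump_def)
qed (use assms in \<open>simp add: fwd_jump_def\<close>)

lemma fwd_jump_Int_atLeast:
  assumes "s \<le> t"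
  shows "fwd_jump (T \<inter> {s..}) t = fwd_jump T t"
proof -
  have "T \<inter> {s..} \<inter> {t<..} = T \<inter> {t<..}" using assms by auto
  then show ?thesis by (simp add: fwd_jump_def)
qed

text \<open>The point \<open>b\<close> rules out that \<open>t\<close> is a maximum of
  \<open>T\<close>, which is its own jump without being right-dense.\<close>

lemma fwd_jump_eq_self_approx:
  assumes "fwd_jump T t = t" "b \<in> T" "t < b" "0 < d"
  obtains r where "r \<in> T" "t < r" "r < t + d" "r \<le> b"
proof -
  have ne: "T \<inter> {t<..} \<noteq> {}" using assms by auto
  then have "Inf (T \<inter> {t<..}) < min (t + d) b"
    using assms by (auto simp: fwd_jump_def)
  from cInf_lessD[OF ne this] show ?thesis using that by force
qed

lemma has_delta_deriv_Int_atLeast: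
  assumes "has_delta_deriv T f D t" "s \<le> t"
  shows "has_delta_deriv (T \<inter> {s..}) f D t"
  using assms unfolding has_delta_deriv_def fwd_jump_Int_atLeast[OF assms(2)] by blast

text \<open>Take \<open>r = t\<close> in the definition: the error is at most a small multiple of
  the graininess. Adding 1 to the graininess in the denominator keeps the quotient meaningful when
  it is 0.\<close>

lemma has_delta_deriv_jump:
  assumes D: "has_delta_deriv T f D t" and t: "t \<in> T"
  shows "f (fwd_jump T t) = f t + D * (fwd_jump T t - t)"
proof -
  let ?\<mu> = "fwd_jump T t - t"
  have \<mu>: "0 \<le> ?\<mu>" using fwd_jump_ge[of t T] by simp
  have "\<bar>f (fwd_jump T t) - f t - D * ?\<mu>\<bar> \<le> 0 + e" if e: "e > 0" for e
  proof -
    have "0 < e / (?\<mu> + 1)" using \<mu> e by simp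
    then obtain d where "d > 0" and d: "\<forall>r\<in>T. \<bar>r - t\<bar> < d \<longrightarrow>
        \<bar>f (fwd_jump T t) - f r - D * (fwd_jump T t - r)\<bar> \<le> e / (?\<mu> + 1) * \<bar>fwd_jump T t - r\<bar>"
      using D unfolding has_delta_deriv_def by meson
    from d t \<open>d > 0\<close> have "\<bar>f (fwd_jump T t) - f t - D * ?\<mu>\<bar> \<le> e / (?\<mu> + 1) * ?\<mu>"
      using \<mu> by force
    also have "\<dots> \<le> e" using \<mu> e by (simp add: field_simps)
    finally show ?thesis by simp
  qed
  then have "\<bar>f (fwd_jump T t) - f t - D * ?\<mu>\<bar> \<le> 0" by (rule field_le_epsilon)
  then show ?thesis by simp
qed

lemma has_delta_deriv_continuous:
  assumes D: "has_delta_deriv T f D t" and t: "t \<in> T"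
  shows "continuous (at t within T) f"
  unfolding continuous_within_eps_delta
proof (intro allI impI)
  fix e :: real assume e: "e > 0"
  let ?\<mu> = "fwd_jump T t - t"
  have \<mu>: "0 \<le> ?\<mu>" using fwd_jump_ge[of t T] by simp
  define c where "c = e / (2 * (?\<mu> + 1))"
  have c: "c > 0" using \<mu> e by (simp add: c_def)
  then obtain d where "d > 0" and d: "\<forall>r\<in>T. \<bar>r - t\<bar> < d \<longrightarrow>
        \<bar>f (fwd_jump T t) - f r - D * (fwd_jump T t - r)\<bar> \<le> c * \<bar>fwd_jump T t - r\<bar>"
    using D unfolding has_delta_deriv_def by meson
  \<comment> \<open>The bound 1 keeps the distance from \<open>r\<close> to the jump below
    \<open>?\<mu> + 1\<close>; the last bound keeps \<open>D * (t - r)\<close> below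
    \<open>e / 2\<close>.\<close>
  define d' where "d' = min (min d 1) (e / (2 * (\<bar>D\<bar> + 1)))"
  have d': "d' > 0" "d' \<le> d" "d' \<le> 1" "d' \<le> e / (2 * (\<bar>D\<bar> + 1))"
    using \<open>d > 0\<close> e by (auto simp: d'_def)
  have "dist (f r) (f t) < e" if r: "r \<in> T" "dist r t < d'" for r
  proof -
    have rt: "\<bar>r - t\<bar> < d'" using r by (simp add: dist_real_def)
    have "\<bar>f (fwd_jump T t) - f r - D * (fwd_jump T t - r)\<bar> \<le> c * \<bar>fwd_jump T t - r\<bar>"
      using d r rt d' by auto
    also have "\<dots> \<le> c * (?\<mu> + 1)"
      using c \<mu> rt d' by (intro mult_left_mono) auto
    also have "\<dots> = e / 2"
    proof -
      have "?\<mu> + 1 \<noteq> 0" using \<mu> by linarith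
      then show ?thesis unfolding c_def by (metis nonzero_mult_divide_mult_cancel_right times_divide_eq_left)
    qed
    finally have 1: "\<bar>f t - f r - D * (t - r)\<bar> \<le> e / 2"
      using has_delta_deriv_jump[OF D t] by (simp add: algebra_simps)
    have "\<bar>D * (t - r)\<bar> \<le> \<bar>D\<bar> * (e / (2 * (\<bar>D\<bar> + 1)))"
      unfolding abs_mult using rt d' by (intro mult_left_mono) auto
    also have "\<dots> < e / 2" using e by (simp add: field_simps)
    finally have 2: "\<bar>D * (t - r)\<bar> < e / 2" .
    define p where "p = D * (t - r)"
    show ?thesis using 1 2 unfolding p_def[symmetric] dist_real_def by linarith
  qed
  then show "\<exists>d>0. \<forall>x'\<in>T. dist x' t < d \<longrightarrow> dist (f x') (f t) < e" using d' by blast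
qed

lemma has_delta_deriv_add_scaled:
  assumes f: "has_delta_deriv T f D t" and g: "has_delta_deriv T g E t"
  shows "has_delta_deriv T (\<lambda>t. f t + c * g t) (D + c * E) t"
  unfolding has_delta_deriv_def
proof (intro allI impI)
  fix e :: real assume e: "e > 0"
  have e': "e / 2 > 0" "e / (2 * (\<bar>c\<bar> + 1)) > 0" using e by auto
  let ?s = "fwd_jump T t"
  obtain d1 where d1: "d1 > 0" "\<forall>r\<in>T. \<bar>r - t\<bar> < d1 \<longrightarrow>
        \<bar>f ?s - f r - D * (?s - r)\<bar> \<le> e / 2 * \<bar>?s - r\<bar>"
    using f e' unfolding has_delta_deriv_def by meson
  obtain d2 where d2: "d2 > 0" "\<forall>r\<in>T. \<bar>r - t\<bar> < d2 \<longrightarrow>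
        \<bar>g ?s - g r - E * (?s - r)\<bar> \<le> e / (2 * (\<bar>c\<bar> + 1)) * \<bar>?s - r\<bar>"
    using g e' unfolding has_delta_deriv_def by meson
  have "\<bar>f ?s + c * g ?s - (f r + c * g r) - (D + c * E) * (?s - r)\<bar> \<le> e * \<bar>?s - r\<bar>"
    if r: "r \<in> T" "\<bar>r - t\<bar> < min d1 d2" for r
  proof -
    have "\<bar>c * (g ?s - g r - E * (?s - r))\<bar> \<le> \<bar>c\<bar> * (e / (2 * (\<bar>c\<bar> + 1)) * \<bar>?s - r\<bar>)"
      unfolding abs_mult using d2 r by (intro mult_left_mono) auto
    also have "\<dots> = (\<bar>c\<bar> * (e / (2 * (\<bar>c\<bar> + 1)))) * \<bar>?s - r\<bar>" by simp
    also have "\<dots> \<le> e / 2 * \<bar>?s - r\<bar>"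
      using e by (intro mult_right_mono) (auto simp: field_simps)
    finally have 1: "\<bar>c * (g ?s - g r - E * (?s - r))\<bar> \<le> e / 2 * \<bar>?s - r\<bar>" .
    have 2: "\<bar>f ?s - f r - D * (?s - r)\<bar> \<le> e / 2 * \<bar>?s - r\<bar>" using d1 r by auto
    have "f ?s + c * g ?s - (f r + c * g r) - (D + c * E) * (?s - r)
       = (f ?s - f r - D * (?s - r)) + c * (g ?s - g r - E * (?s - r))"
      by (simp add: algebra_simps)
    with 1 2 show ?thesis by linarith
  qed
  then show "\<exists>d>0. \<forall>r\<in>T. \<bar>r - t\<bar> < d \<longrightarrow>
     \<bar>f ?s + c * g ?s - (f r + c * g r) - (D + c * E) * (?s - r)\<bar> \<le> e * \<bar>?s - r\<bar>"
    using d1 d2 by (intro exI[of _ "min d1 d2"]) auto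
qed

lemma has_delta_deriv_uminus:
  assumes "has_delta_deriv T f D t"
  shows "has_delta_deriv T (\<lambda>t. - f t) (- D) t"
proof -
  have "has_delta_deriv T (\<lambda>t. 0) 0 t" by (auto simp: has_delta_deriv_def intro!: exI[of _ 1])
  from has_delta_deriv_add_scaled[OF this assms, of "- 1"] show ?thesis by simp
qed

lemma delta_differentiable_continuous_on:
  assumes "\<forall>t\<in>T \<inter> I. has_delta_deriv T f (D t) t"
  shows "continuous_on (T \<inter> I) f"
  unfolding continuous_on_eq_continuous_within
  using assms has_delta_deriv_continuous continuous_within_subset by (metis Int_iff inf_le1)

section \<open>Monotonicity, barrier and comparison principles\<close>

text \<open>The sublevel set is compact, so it has a maximum. This replaces induction along the time
  scale: to show \<open>c = b\<close>, it suffices to find a further point of the sublevel set to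
  the right of any such \<open>c < b\<close>.\<close>

lemma last_point_below:
  fixes h :: "real \<Rightarrow> real"
  assumes "closed T" "continuous_on (T \<inter> {a..b}) h" "a \<in> T" "a \<le> b" "h a \<le> C"
  obtains c where "c \<in> T" "a \<le> c" "c \<le> b" "h c \<le> C"
    "\<And>r. r \<in> T \<Longrightarrow> c < r \<Longrightarrow> r \<le> b \<Longrightarrow> C < h r"
proof -
  let ?G = "{t \<in> T \<inter> {a..b}. h t \<le> C}"
  have "closed ?G"
    using assms by (intro continuous_on_closed_Collect_le) (auto intro: continuous_intros)
  moreover have "?G \<subseteq> {a..b}" by auto
  ultimately have "compact ?G"
    by (meson bounded_closed_interval bounded_subset compact_eq_bounded_closed)
  moreover have "?G \<noteq> {}" using assms by force
  ultimately obtain c where "c \<in> ?G" "\<forall>t\<in>?G. t \<le> c" using compact_attains_sup by meson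
  then show ?thesis by (intro that[of c]) force+
qed

text \<open>Tilting \<open>f\<close> by \<open>- e * t\<close> makes the decrease strict. If the
  last point \<open>c\<close> with \<open>h c \<le> h a\<close> were before \<open>b\<close>, then
  the jump of \<open>c\<close>, or a nearby point if \<open>c\<close> is right-dense, would be a
  later one.\<close>

lemma delta_deriv_nonpos_imp_le:
  assumes T: "closed T" "a \<in> T" "b \<in> T" "a \<le> b"
    and D: "\<forall>t\<in>T \<inter> {a..b}. has_delta_deriv T f (D t) t"
    and le: "\<forall>t\<in>T \<inter> {a..<b}. D t \<le> 0"
  shows "f b \<le> f a"
proof (rule field_le_epsilon)
  fix e' :: real assume e': "e' > 0"
  define e where "e = e' / (b - a + 1)"
  have e: "e > 0" using e' T by (simp add: e_def)
  define h where "h t = f t - e * t" for t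
  have "continuous_on (T \<inter> {a..b}) h"
    unfolding h_def by (intro continuous_intros delta_differentiable_continuous_on[OF D])
  then obtain c where c: "c \<in> T" "a \<le> c" "c \<le> b" "h c \<le> h a"
    and last: "\<And>r. r \<in> T \<Longrightarrow> c < r \<Longrightarrow> r \<le> b \<Longrightarrow> h a < h r"
    using T last_point_below[of T a b h "h a"] by (metis order_refl)
  have "c = b"
  proof (rule ccontr)
    assume "c \<noteq> b"
    then have cb: "c < b" using c by simp
    have Dc: "has_delta_deriv T f (D c) c" "D c \<le> 0" using D le c cb by auto
    show False
    proof (cases "fwd_jump T c = c")
      case False
      then have less: "c < fwd_jump T c" using fwd_jump_ge[of c T] by simp
      have "D c * (fwd_jump T c - c) \<le> 0"
        using Dc less by (intro mult_nonpos_nonneg) auto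
      then have "f (fwd_jump T c) \<le> f c"
        using has_delta_deriv_jump[OF Dc(1) c(1)] by simp
      moreover have "e * c \<le> e * fwd_jump T c" using e less by simp
      ultimately have "h (fwd_jump T c) \<le> h a" using c unfolding h_def by linarith
      then show False
        using last[OF fwd_jump_in[OF T(1) c(1)] less fwd_jump_le[OF T(3) cb]] by simp
    next
      case True
      obtain d where d: "d > 0" "\<forall>r\<in>T. \<bar>r - c\<bar> < d \<longrightarrow>
          \<bar>f (fwd_jump T c) - f r - D c * (fwd_jump T c - r)\<bar> \<le> e * \<bar>fwd_jump T c - r\<bar>"
        using Dc(1) e unfolding has_delta_deriv_def by meson
      obtain r where r: "r \<in> T" "c < r" "r < c + d" "r \<le> b"
        using fwd_jump_eq_self_approx[OF True T(3) cb d(1)] .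
      have "\<bar>f c - f r - D c * (c - r)\<bar> \<le> e * \<bar>c - r\<bar>" using d r True by auto
      moreover have "D c * (c - r) \<ge> 0" using Dc r by (intro mult_nonpos_nonpos) auto
      ultimately have "f r - e * r \<le> f c - e * c"
        using r by (simp add: algebra_simps)
      then show False using last[of r] r c unfolding h_def by simp
    qed
  qed
  then have "f b \<le> f a + e * (b - a)" using c by (simp add: h_def algebra_simps)
  also have "e * (b - a) \<le> e'" using e' T by (simp add: e_def field_simps)
  finally show "f b \<le> f a + e'" by simp
qed

text \<open>After the last point \<open>c\<close> with \<open>f c \<le> C\<close> every jump lands
  above \<open>C\<close>, so \<open>D\<close> is nonpositive there and \<open>f\<close> cannot have
  risen. The condition is put on the value after the jump because a single jump may cross the level
  \<open>C\<close>.\<close>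

lemma delta_deriv_barrier:
  assumes T: "closed T" "a \<in> T" "b \<in> T" "a \<le> b"
    and D: "\<forall>t\<in>T \<inter> {a..b}. has_delta_deriv T f (D t) t"
    and start: "f a \<le> C"
    and jump: "\<And>t. t \<in> T \<Longrightarrow> a \<le> t \<Longrightarrow> t < b \<Longrightarrow> D t > 0 \<Longrightarrow> f (fwd_jump T t) \<le> C"
  shows "f b \<le> C"
proof (rule ccontr)
  assume fb: "\<not> f b \<le> C"
  have cont: "continuous_on (T \<inter> {a..b}) f"
    by (rule delta_differentiable_continuous_on[OF D])
  obtain c where c: "c \<in> T" "a \<le> c" "c \<le> b" "f c \<le> C"
    and last: "\<And>r. r \<in> T \<Longrightarrow> c < r \<Longrightarrow> r \<le> b \<Longrightarrow> C < f r"
    using last_point_below[OF T(1) cont T(2,4) start] by blast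
  have cb: "c < b" using c fb by (cases "c = b") auto
  have Dc: "has_delta_deriv T f (D c) c" using D c by auto
  show False
  proof (cases "fwd_jump T c = c")
    case False
    then have less: "c < fwd_jump T c" using fwd_jump_ge[of c T] by simp
    have gt: "C < f (fwd_jump T c)"
      using last[OF fwd_jump_in[OF T(1) c(1)] less fwd_jump_le[OF T(3) cb]] .
    then have "D c \<le> 0" using jump[of c] c cb by force
    then have "D c * (fwd_jump T c - c) \<le> 0"
      using less by (intro mult_nonpos_nonneg) auto
    then show False using has_delta_deriv_jump[OF Dc c(1)] gt c by simp
  next
    case True
    \<comment> \<open>Monotonicity is available only to the right of \<open>c\<close>; continuity at
      the right-dense point \<open>c\<close> then carries it over to \<open>c\<close>.\<close>
    have decr: "f b \<le> f r" if r: "r \<in> T" "c < r" "r \<le> b" for r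
    proof (rule delta_deriv_nonpos_imp_le[OF T(1) r(1) T(3) r(3), where D = D])
      show "\<forall>t\<in>T \<inter> {r..b}. has_delta_deriv T f (D t) t" using D r c by auto
      show "\<forall>t\<in>T \<inter> {r..<b}. D t \<le> 0"
      proof
        fix t assume t: "t \<in> T \<inter> {r..<b}"
        have "C < f (fwd_jump T t)"
        proof (rule last)
          show "fwd_jump T t \<in> T" using fwd_jump_in T(1) t by blast
          show "c < fwd_jump T t" using fwd_jump_ge[of t T] t r by simp
          show "fwd_jump T t \<le> b" using fwd_jump_le[OF T(3)] t by simp
        qed
        then show "D t \<le> 0" using jump[of t] t r c by force
      qed
    qed
    have "f b \<le> f c"
    proof (rule field_le_epsilon)
      fix e :: real assume "e > 0"
      then obtain d where d: "d > 0" "\<forall>r\<in>T. dist r c < d \<longrightarrow> dist (f r) (f c) < e"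
        using has_delta_deriv_continuous[OF Dc c(1)] unfolding continuous_within_eps_delta by meson
      obtain r where r: "r \<in> T" "c < r" "r < c + d" "r \<le> b"
        using fwd_jump_eq_self_approx[OF True T(3) cb d(1)] .
      have "dist (f r) (f c) < e" using d r by (auto simp: dist_real_def)
      then show "f b \<le> f c + e" using decr[of r] r by (simp add: dist_real_def)
    qed
    then show False using fb c by simp
  qed
qed

lemma delta_deriv_comparison:
  assumes T: "closed T" "a \<in> T" "b \<in> T" "a \<le> b"
    and f: "\<forall>t\<in>T \<inter> {a..b}. has_delta_deriv T f (D t) t"
    and g: "\<forall>t\<in>T \<inter> {a..b}. has_delta_deriv T g (E t) t"
    and le: "\<And>t. t \<in> T \<Longrightarrow> a \<le> t \<Longrightarrow> t < b \<Longrightarrow> D t \<le> c * E t"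
  shows "f b - f a \<le> c * (g b - g a)"
proof -
  have "f b + (- c) * g b \<le> f a + (- c) * g a"
  proof (rule delta_deriv_nonpos_imp_le[OF T, where D = "\<lambda>t. D t + (- c) * E t"])
    show "\<forall>t\<in>T \<inter> {a..b}. has_delta_deriv T (\<lambda>t. f t + (- c) * g t) (D t + (- c) * E t) t"
      using has_delta_deriv_add_scaled f g by blast
  qed (use le in auto)
  then show ?thesis by (simp add: algebra_simps)
qed

section \<open>Antiderivatives of rd-continuous functions\<close>

text \<open>Bisection: approximations on adjacent intervals can be glued, and near each point the
  two one-sided near-limits give one with at most three values. Integrability of \<open>h\<close>
  and boundedness of \<open>g\<close> are carried along together.\<close>

lemma regulated_step_approx:
  fixes g :: "real \<Rightarrow> real"
  assumes ab: "a \<le> b" and e: "0 < e"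
    and left: "\<And>x. \<exists>l d. 0 < d \<and> (\<forall>u. x - d < u \<and> u < x \<longrightarrow> \<bar>g u - l\<bar> \<le> e)"
    and right: "\<And>x. \<exists>l d. 0 < d \<and> (\<forall>u. x < u \<and> u < x + d \<longrightarrow> \<bar>g u - l\<bar> \<le> e)"
  shows "\<exists>h B. h integrable_on {a..b} \<and> (\<forall>u\<in>{a..b}. \<bar>g u - h u\<bar> \<le> e \<and> \<bar>g u\<bar> \<le> B)"
  using ab
proof (induction rule: Bolzano)
  case (trans a b c)
  obtain h1 B1 where 1: "h1 integrable_on {a..b}" "\<forall>u\<in>{a..b}. \<bar>g u - h1 u\<bar> \<le> e \<and> \<bar>g u\<bar> \<le> B1"
    using trans by blast
  obtain h2 B2 where 2: "h2 integrable_on {b..c}" "\<forall>u\<in>{b..c}. \<bar>g u - h2 u\<bar> \<le> e \<and> \<bar>g u\<bar> \<le> B2"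
    using trans by blast
  let ?h = "\<lambda>u. if u \<le> b then h1 u else h2 u"
  have "?h integrable_on {a..b}" using integrable_eq[OF 1(1)] by simp
  moreover have "?h integrable_on {b..c}"
    by (rule integrable_spike_finite[OF _ _ 2(1), of "{b}"]) auto
  ultimately have "?h integrable_on {a..c}" using integrable_combine trans by blast
  moreover have "\<forall>u\<in>{a..c}. \<bar>g u - ?h u\<bar> \<le> e \<and> \<bar>g u\<bar> \<le> max B1 B2"
    using 1(2) 2(2) by (auto simp: le_max_iff_disj)
  ultimately show ?case by blast
next
  case (local x)
  obtain l d1 where l: "0 < d1" "\<forall>u. x - d1 < u \<and> u < x \<longrightarrow> \<bar>g u - l\<bar> \<le> e"
    using left by blast
  obtain r d2 where r: "0 < d2" "\<forall>u. x < u \<and> u < x + d2 \<longrightarrow> \<bar>g u - r\<bar> \<le> e"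
    using right by blast
  let ?h = "\<lambda>u. if u < x then l else if u = x then g x else r"
  have *: "\<exists>h B. h integrable_on {a..b} \<and> (\<forall>u\<in>{a..b}. \<bar>g u - h u\<bar> \<le> e \<and> \<bar>g u\<bar> \<le> B)"
    if ab: "a \<le> x" "x \<le> b" "b - a < min d1 d2" for a b
  proof -
    have "?h integrable_on {a..x}"
      by (rule integrable_spike_finite[OF _ _ integrable_const_ivl, of "{x}" _ _ _ l]) auto
    moreover have "?h integrable_on {x..b}"
      by (rule integrable_spike_finite[OF _ _ integrable_const_ivl, of "{x}" _ _ _ r]) auto
    ultimately have "?h integrable_on {a..b}" using integrable_combine ab by blast
    moreover have "\<bar>g u - ?h u\<bar> \<le> e" if "u \<in> {a..b}" for u
    proof -
      have "u < x \<Longrightarrow> \<bar>g u - l\<bar> \<le> e" "x < u \<Longrightarrow> \<bar>g u - r\<bar> \<le> e"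
        using l(2) r(2) ab that by auto
      then show ?thesis using e by auto
    qed
    moreover from this have "\<bar>g u\<bar> \<le> \<bar>l\<bar> + \<bar>r\<bar> + \<bar>g x\<bar> + e" if "u \<in> {a..b}" for u
      using that by (smt (verit))
    ultimately show ?thesis by blast
  qed
  then show ?case using l(1) r(1) by (intro exI[of _ "min d1 d2"]) auto
qed

section \<open>Extension of rd-continuous functions to the real line\<close>

text \<open>Composing \<open>f\<close> with this map extends \<open>f\<close> from \<open>S\<close>
  by the constant \<open>f t\<close> over each gap from \<open>t\<close> to its jump, so that
  ordinary integrals of the extension are delta integrals of \<open>f\<close>.\<close>

definition last_before :: "real set \<Rightarrow> real \<Rightarrow> real" where
  "last_before S u = Sup (S \<inter> {..u})"

lemma last_before_between:
  assumes "closed S" "r \<in> S" "r \<le> u"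
  shows "last_before S u \<in> S" "r \<le> last_before S u" "last_before S u \<le> u"
proof -
  have ne: "S \<inter> {..u} \<noteq> {}" and bdd: "bdd_above (S \<inter> {..u})" using assms by auto
  have "last_before S u \<in> closure (S \<inter> {..u})"
    unfolding last_before_def by (rule closure_contains_Sup[OF ne bdd])
  also have "\<dots> = S \<inter> {..u}" using assms by (intro closure_closed closed_Int) auto
  finally show "last_before S u \<in> S" "last_before S u \<le> u" by auto
  show "r \<le> last_before S u"
    unfolding last_before_def using assms bdd by (intro cSup_upper) auto
qed

lemma last_before_self:
  assumes "closed S" "t \<in> S"
  shows "last_before S t = t"
  using last_before_between[OF assms order_refl] by simp

text \<open>Either a gap lies to the left of \<open>x\<close> and the extension is constant there,
  or \<open>x\<close> is a limit of smaller points of \<open>S\<close>, hence a left-dense point of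
  \<open>S\<close>, and rd-continuity supplies the limit.\<close>

lemma rd_continuous_left_limit:
  assumes S: "closed S" and f: "rd_continuous_on S f" and e: "0 < (e::real)"
  shows "\<exists>l d. 0 < d \<and> (\<forall>u. x - d < u \<and> u < x \<longrightarrow> \<bar>f (last_before S u) - l\<bar> \<le> e)"
proof (cases "\<exists>d>0. S \<inter> {x - d<..<x} = {}")
  case True
  then obtain d where d: "d > 0" "S \<inter> {x - d<..<x} = {}" by blast
  \<comment> \<open>This includes \<open>x\<close> below all of \<open>S\<close>: both sets are then
    empty and have the same default supremum.\<close>
  have "S \<inter> {..u} = S \<inter> {..x - d}" if "x - d < u" "u < x" for u
    using d(2) that by force
  then show ?thesis
    using d(1) e by (intro exI[of _ "f (last_before S (x - d))"] exI[of _ d])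
      (simp add: last_before_def)
next
  case False
  then have acc: "\<exists>s\<in>S. x - d < s \<and> s < x" if "d > 0" for d using that by fastforce
  have "x \<in> S"
    unfolding closed_approachable[OF S, symmetric]
    using acc by (force simp: dist_real_def)
  moreover have "left_dense S x"
  proof -
    have ne: "S \<inter> {..<x} \<noteq> {}" using acc[of 1] by auto
    have "Sup (S \<inter> {..<x}) \<le> x" using ne by (intro cSup_least) auto
    moreover have "\<not> Sup (S \<inter> {..<x}) < x"
    proof
      assume "Sup (S \<inter> {..<x}) < x"
      then obtain s where s: "s \<in> S" "Sup (S \<inter> {..<x}) < s" "s < x"
        using acc[of "x - Sup (S \<inter> {..<x})"] by auto
      have "bdd_above (S \<inter> {..<x})" by (rule bdd_aboveI[of _ x]) auto
      with s have "s \<le> Sup (S \<inter> {..<x})" by (intro cSup_upper) auto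
      with s show False by simp
    qed
    ultimately show ?thesis using ne by (simp add: left_dense_def bwd_jump_def)
  qed
  ultimately obtain l where "(f \<longlongrightarrow> l) (at x within S \<inter> {..<x})"
    using f unfolding rd_continuous_on_def by blast
  then obtain d where d: "d > 0"
    "\<forall>v\<in>S \<inter> {..<x}. 0 < dist v x \<and> dist v x < d \<longrightarrow> dist (f v) l < e"
    unfolding Lim_within using e by blast
  \<comment> \<open>For \<open>u\<close> beyond \<open>s\<close>, \<open>last_before S u\<close> is
    caught between \<open>s\<close> and \<open>u\<close>, hence stays within \<open>d\<close> of
    \<open>x\<close>.\<close>
  obtain s where s: "s \<in> S" "x - d < s" "s < x" using acc d(1) by blast
  have "\<bar>f (last_before S u) - l\<bar> \<le> e" if "x - (x - s) < u" "u < x" for u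
    using last_before_between[OF S s(1), of u] that s d(2)[rule_format, of "last_before S u"]
    by (force simp: dist_real_def)
  then show ?thesis using s by (intro exI[of _ l] exI[of _ "x - s"]) auto
qed

lemma rd_continuous_right_limit:
  assumes S: "closed S" and f: "rd_continuous_on S f" and e: "0 < (e::real)"
  shows "\<exists>l d. 0 < d \<and> (\<forall>u. x < u \<and> u < x + d \<longrightarrow> \<bar>f (last_before S u) - l\<bar> \<le> e)"
proof (cases "\<exists>d>0. S \<inter> {x<..<x + d} = {}")
  case True
  then obtain d where d: "d > 0" "S \<inter> {x<..<x + d} = {}" by blast
  have "S \<inter> {..u} = S \<inter> {..x}" if "x < u" "u < x + d" for u
    using d(2) that by force
  then show ?thesis
    using d(1) e by (intro exI[of _ "f (last_before S x)"] exI[of _ d])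
      (simp add: last_before_def)
next
  case False
  then have acc: "\<exists>s\<in>S. x < s \<and> s < x + d" if "d > 0" for d using that by fastforce
  have x: "x \<in> S"
    unfolding closed_approachable[OF S, symmetric]
    using acc by (force simp: dist_real_def)
  moreover have "right_dense S x"
  proof -
    have "\<not> x < fwd_jump S x"
      using acc[of "fwd_jump S x - x"] fwd_jump_le[of _ S x] by force
    then have "fwd_jump S x = x" using fwd_jump_ge[of x S] by simp
    then show ?thesis using acc[of 1] by (auto simp: right_dense_def graininess_def)
  qed
  ultimately have "continuous (at x within S) f"
    using f unfolding rd_continuous_on_def by blast
  then obtain d where d: "d > 0" "\<forall>v\<in>S. dist v x < d \<longrightarrow> dist (f v) (f x) < e"
    unfolding continuous_within_eps_delta using e by blast
  have "\<bar>f (last_before S u) - f x\<bar> \<le> e" if "x < u" "u < x + d" for u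
    using last_before_between[OF S x, of u] that d(2)[rule_format, of "last_before S u"]
    by (force simp: dist_real_def)
  then show ?thesis using d(1) by (intro exI[of _ "f x"] exI[of _ d]) auto
qed

lemma rd_continuous_step_approx:
  assumes "closed S" "rd_continuous_on S f" "a \<le> b" "0 < (e::real)"
  shows "\<exists>h B. h integrable_on {a..b} \<and>
    (\<forall>u\<in>{a..b}. \<bar>f (last_before S u) - h u\<bar> \<le> e \<and> \<bar>f (last_before S u)\<bar> \<le> B)"
  using regulated_step_approx[OF assms(3,4), of "\<lambda>u. f (last_before S u)"]
    rd_continuous_left_limit[OF assms(1,2,4)] rd_continuous_right_limit[OF assms(1,2,4)] by blast

lemma rd_continuous_bounded:
  assumes "closed S" "rd_continuous_on S f"
  obtains B :: real where "\<And>t. t \<in> S \<Longrightarrow> a \<le> t \<Longrightarrow> t \<le> b \<Longrightarrow> \<bar>f t\<bar> \<le> B"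
proof (cases "a \<le> b")
  case True
  then obtain h B where "\<forall>u\<in>{a..b}. \<bar>f (last_before S u) - h u\<bar> \<le> 1 \<and> \<bar>f (last_before S u)\<bar> \<le> B"
    using rd_continuous_step_approx[OF assms, of a b 1] by auto
  then show ?thesis using that[of B] last_before_self[OF assms(1)] by force
qed (use that in force)

lemma rd_continuous_integrable:
  assumes "closed S" "rd_continuous_on S f"
  shows "(\<lambda>u. f (last_before S u)) integrable_on {a..b::real}"
proof (cases "a \<le> b")
  case True
  show ?thesis
    unfolding box_real(2)[symmetric]
    by (rule integrable_uniform_limit)
      (use rd_continuous_step_approx[OF assms True] in \<open>simp, blast\<close>)
qed (simp add: integrable_on_empty)

text \<open>The antiderivative is the ordinary integral of the extension. Existence matters because
  \<open>delta_integral\<close> chooses by \<open>SOME\<close>, which is meaningful only if there is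
  something to choose.\<close>

lemma rd_continuous_imp_antideriv:
  assumes S: "closed S" "t0 \<in> S" "S \<subseteq> {t0..}" and f: "rd_continuous_on S f"
    and unbdd: "\<not> bdd_above S"
  shows "\<exists>F. delta_antideriv S f F"
proof -
  define g where "g u = f (last_before S u)" for u
  have int: "g integrable_on {a..b}" for a b
    unfolding g_def by (rule rd_continuous_integrable[OF S(1) f])
  define G where "G t = integral {t0..t} g" for t
  have G: "(g has_integral G b - G a) {a..b}" if "t0 \<le> a" "a \<le> b" for a b
  proof -
    have "integral {a..b} g = G b - G a"
      using integral_combine[OF that int] unfolding G_def by simp
    then show ?thesis using integrable_integral[OF int, of a b] by simp
  qed
  have "has_delta_deriv S G (f t) t" if t: "t \<in> S" for t
    unfolding has_delta_deriv_def
  proof (intro allI impI)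
    fix e :: real assume e: "e > 0"
    let ?s = "fwd_jump S t"
    have t0: "t0 \<le> t" using t S by auto
    \<comment> \<open>With a point beyond \<open>t\<close>, the equation \<open>?s = t\<close> does
      mean that \<open>t\<close> is right-dense.\<close>
    obtain b where b: "b \<in> S" "t < b" using unbdd by (meson bdd_aboveI not_le)
    show "\<exists>d>0. \<forall>r\<in>S. \<bar>r - t\<bar> < d \<longrightarrow> \<bar>G ?s - G r - f t * (?s - r)\<bar> \<le> e * \<bar>?s - r\<bar>"
    proof (cases "?s = t")
      case True
      then have "continuous (at t within S) f"
        using f b t unfolding rd_continuous_on_def right_dense_def graininess_def by auto
      then obtain d where d: "d > 0" "\<forall>v\<in>S. dist v t < d \<longrightarrow> dist (f v) (f t) < e"
        unfolding continuous_within_eps_delta using e by blast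
      have *: "\<bar>G v - G r - f t * (v - r)\<bar> \<le> e * (v - r)"
        if r: "r \<in> S" "t - d < r" "r \<le> v" "v < t + d" for r v
      proof -
        have "((\<lambda>u. g u - f t) has_integral (G v - G r) - (v - r) *\<^sub>R f t) {r..v}"
          using S r has_integral_const_real[of "f t" r v]
          by (intro has_integral_diff G) auto
        moreover have "norm (g u - f t) \<le> e" if "u \<in> {r..v}" for u
          using last_before_between[OF S(1) r(1), of u] that r
            d(2)[rule_format, of "last_before S u"]
          by (force simp: dist_real_def g_def)
        ultimately have "norm ((G v - G r) - (v - r) *\<^sub>R f t) \<le> e * content {r..v}"
          using e by (intro has_integral_bound_real) auto
        then show ?thesis using r by (simp add: mult.commute)
      qed
      have "\<bar>G t - G r - f t * (t - r)\<bar> \<le> e * \<bar>t - r\<bar>" if r: "r \<in> S" "\<bar>r - t\<bar> < d" for r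
      proof (cases "r \<le> t")
        case True
        then show ?thesis using *[of r t] r d(1) by simp
      next
        case False
        then have "\<bar>G r - G t - f t * (r - t)\<bar> \<le> e * (r - t)"
          using *[of t r] r t d(1) by simp
        then show ?thesis using False by (simp add: algebra_simps abs_if split: if_splits)
      qed
      then show ?thesis using d True by auto
    next
      case False
      then have less: "t < ?s" using fwd_jump_ge[of t S] by simp
      have "last_before S u = t" if "t \<le> u" "u < ?s" for u
        using last_before_between[OF S(1) t that(1)] fwd_jump_le[of "last_before S u" S t] that
        by force
      then have eq: "g u = f t" if "u \<in> {t..?s} - {?s}" for u using that by (auto simp: g_def)
      have "((\<lambda>_. f t) has_integral (?s - t) * f t) {t..?s}"
        using has_integral_const_real[of "f t" t ?s] less by simp
      then have "(g has_integral (?s - t) * f t) {t..?s}"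
        by (rule has_integral_spike_finite[of "{?s}", rotated 2]) (use eq in auto)
      then have Gs: "G ?s - G t = (?s - t) * f t"
        using has_integral_unique[OF G[OF t0]] less by force
      \<comment> \<open>At a right-scattered point the error equals \<open>H t - H r\<close>
        exactly. It tends to 0, while the allowed error stays above \<open>e\<close> times half the
        graininess once \<open>r\<close> is close to \<open>t\<close>.\<close>
      define H where "H r = G r - f t * r" for r
      have "continuous_on {t0..t + 1} H"
        unfolding H_def G_def by (intro continuous_intros indefinite_integral_continuous_1 int)
      then obtain d where d: "d > 0"
        "\<forall>v\<in>{t0..t + 1}. dist v t < d \<longrightarrow> dist (H v) (H t) < e * ((?s - t) / 2)"
        unfolding continuous_on_iff using t0 e less
        by (metis add_increasing2 atLeastAtMost_iff half_gt_zero diff_gt_0_iff_gt less_eq_real_def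
            mult_pos_pos order_refl zero_le_one)
      have "\<bar>G ?s - G r - f t * (?s - r)\<bar> \<le> e * \<bar>?s - r\<bar>"
        if r: "r \<in> S" "\<bar>r - t\<bar> < min (min d 1) ((?s - t) / 2)" for r
      proof -
        have "dist (H r) (H t) < e * ((?s - t) / 2)"
          using d(2) r S by (auto simp: dist_real_def)
        also have "\<dots> \<le> e * \<bar>?s - r\<bar>"
          using r e by (intro mult_left_mono) (auto simp: abs_if split: if_splits)
        finally have "\<bar>H t - H r\<bar> \<le> e * \<bar>?s - r\<bar>" by (simp add: dist_real_def)
        moreover have "G ?s - G r - f t * (?s - r) = H t - H r"
          using Gs by (simp add: H_def algebra_simps)
        ultimately show ?thesis by simp
      qed
      then show ?thesis
        using d(1) less by (intro exI[of _ "min (min d 1) ((?s - t) / 2)"]) auto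
    qed
  qed
  then show ?thesis unfolding delta_antideriv_def by blast
qed

section \<open>Delay equations with a small window integral\<close>

text \<open>Integrals of \<open>A\<close> enter as increments of one antiderivative
  \<open>F\<close>. \<open>window\<close> admits every \<open>u\<close> from
  \<open>\<alpha> t\<close> on, so that \<open>u\<close> can be the initial time when
  \<open>\<alpha> t\<close> precedes it.\<close>

locale delay_dynamic =
  fixes T :: "real set" and t0 :: real and A \<alpha> F :: "real \<Rightarrow> real" and l :: real
  assumes closed_T: "closed T"
    and t0_in: "t0 \<in> T"
    and A_nonneg: "\<And>t. t \<in> T \<Longrightarrow> t0 \<le> t \<Longrightarrow> 0 \<le> A t"
    and \<alpha>_in: "\<And>t. t \<in> T \<Longrightarrow> t0 \<le> t \<Longrightarrow> \<alpha> t \<in> T"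
    and \<alpha>_le: "\<And>t. t \<in> T \<Longrightarrow> t0 \<le> t \<Longrightarrow> \<alpha> t \<le> t"
    and \<alpha>_unbounded: "\<And>N. \<exists>a\<in>T. N \<le> a \<and> (\<forall>t\<in>T. a \<le> t \<longrightarrow> N \<le> \<alpha> t)"
    and F_deriv: "delta_antideriv (T \<inter> {t0..}) A F"
    and F_unbounded: "\<And>N. \<exists>a\<in>T. \<forall>t\<in>T. a \<le> t \<longrightarrow> N \<le> F t"
    and l_nonneg: "0 \<le> l" and l_less_1: "l < 1"
    and window: "\<And>t u. t \<in> T \<Longrightarrow> t0 \<le> t \<Longrightarrow> u \<in> T \<Longrightarrow> t0 \<le> u \<Longrightarrow> \<alpha> t \<le> u \<Longrightarrow>
      F (fwd_jump T t) - F u \<le> l"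
begin

text \<open>Only the equation is kept, without data or history, so that the notion survives a later
  restart and a change of sign.\<close>

definition solves :: "real \<Rightarrow> (real \<Rightarrow> real) \<Rightarrow> bool" where
  "solves s x \<longleftrightarrow> (\<forall>t\<in>T \<inter> {s..}. has_delta_deriv (T \<inter> {s..}) x (- (A t * x (\<alpha> t))) t)"

lemma solves_later:
  assumes "solves s x" "s \<le> s'"
  shows "solves s' x"
proof -
  have "T \<inter> {s..} \<inter> {s'..} = T \<inter> {s'..}" using assms(2) by auto
  then show ?thesis
    using assms has_delta_deriv_Int_atLeast[of "T \<inter> {s..}" x _ _ s']
    unfolding solves_def by force
qed

lemma solves_uminus:
  assumes "solves s x"
  shows "solves s (\<lambda>t. - x t)"
  using assms has_delta_deriv_uminus unfolding solves_def by fastforce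

lemma F_deriv_from:
  assumes "t0 \<le> s" "t \<in> T \<inter> {s..}"
  shows "has_delta_deriv (T \<inter> {s..}) F (A t) t"
proof -
  have "T \<inter> {t0..} \<inter> {s..} = T \<inter> {s..}" using assms(1) by auto
  then show ?thesis
    using assms F_deriv has_delta_deriv_Int_atLeast[of "T \<inter> {t0..}" F "A t" t s]
    unfolding delta_antideriv_def by force
qed

text \<open>Comparison of \<open>x\<close> with \<open>K * F\<close>, using
  \<open>A \<ge> 0\<close>. The sign of \<open>K\<close> is free: 0 yields monotonicity, a negative
  \<open>K\<close> yields decay driven by \<open>F\<close>.\<close>

lemma solution_increment_le:
  assumes x: "solves s x" and s: "t0 \<le> s" "s \<le> u" and ub: "u \<in> T" "b \<in> T" "u \<le> b"
    and K: "\<And>t. t \<in> T \<Longrightarrow> u \<le> t \<Longrightarrow> t < b \<Longrightarrow> - x (\<alpha> t) \<le> K"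
  shows "x b - x u \<le> K * (F b - F u)"
proof (rule delta_deriv_comparison[where T = "T \<inter> {s..}" and D = "\<lambda>t. - (A t * x (\<alpha> t))" and E = A])
  show "closed (T \<inter> {s..})" using closed_T by (intro closed_Int) auto
  show "u \<in> T \<inter> {s..}" "b \<in> T \<inter> {s..}" "u \<le> b" using s ub by auto
  show "\<forall>t\<in>T \<inter> {s..} \<inter> {u..b}. has_delta_deriv (T \<inter> {s..}) x (- (A t * x (\<alpha> t))) t"
    using x unfolding solves_def by auto
  show "\<forall>t\<in>T \<inter> {s..} \<inter> {u..b}. has_delta_deriv (T \<inter> {s..}) F (A t) t"
    using F_deriv_from[OF s(1)] by blast
  fix t assume t: "t \<in> T \<inter> {s..}" "u \<le> t" "t < b"
  then have "A t * - x (\<alpha> t) \<le> A t * K"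
    using K A_nonneg s by (intro mult_left_mono) auto
  then show "- (A t * x (\<alpha> t)) \<le> K * A t" by (simp add: mult.commute)
qed

lemma solution_barrier:
  assumes x: "solves s x" and s: "t0 \<le> s" "s \<le> a" and ab: "a \<in> T" "b \<in> T" "a \<le> b"
    and start: "x a \<le> C"
    and jump: "\<And>t. t \<in> T \<Longrightarrow> a \<le> t \<Longrightarrow> t < b \<Longrightarrow> x (\<alpha> t) < 0 \<Longrightarrow> x (fwd_jump T t) \<le> C"
  shows "x b \<le> C"
proof (rule delta_deriv_barrier[where f = x and a = a and b = b and T = "T \<inter> {s..}" and D = "\<lambda>t. - (A t * x (\<alpha> t))"])
  show "closed (T \<inter> {s..})" using closed_T by (intro closed_Int) auto
  show "a \<in> T \<inter> {s..}" "b \<in> T \<inter> {s..}" using s ab by auto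
  show "\<forall>t\<in>T \<inter> {s..} \<inter> {a..b}. has_delta_deriv (T \<inter> {s..}) x (- (A t * x (\<alpha> t))) t"
    using x unfolding solves_def by auto
  show "x (fwd_jump (T \<inter> {s..}) t) \<le> C"
    if t: "t \<in> T \<inter> {s..}" "a \<le> t" "t < b" "0 < - (A t * x (\<alpha> t))" for t
  proof -
    have "x (\<alpha> t) < 0" using A_nonneg[of t] t s by (auto simp: mult_less_0_iff)
    then show ?thesis using jump t fwd_jump_Int_atLeast[of s t T] by simp
  qed
qed (use assms in auto)

section \<open>A priori bounds and uniform stability\<close>

text \<open>By the barrier only jumps from points \<open>t\<close> with
  \<open>x (\<alpha> t) < 0\<close> need control, and these gain at most \<open>K * l\<close> over a
  value that is at most \<open>N\<close>.\<close>

lemma solution_upper_bound: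
  assumes x: "solves s x" and s: "t0 \<le> s" "s \<in> T" and b: "b \<in> T" "s \<le> b"
    and hist: "\<And>t. t \<in> T \<Longrightarrow> s \<le> t \<Longrightarrow> \<alpha> t < s \<Longrightarrow> \<bar>x (\<alpha> t)\<bar> \<le> N"
    and N: "\<bar>x s\<bar> \<le> N" "N \<le> K"
    and K: "\<And>r. r \<in> T \<Longrightarrow> s \<le> r \<Longrightarrow> r \<le> b \<Longrightarrow> \<bar>x r\<bar> \<le> K"
  shows "x b \<le> N + K * l"
proof (rule solution_barrier[OF x s(1) order_refl s(2) b])
  have K0: "0 \<le> K" using N by linarith
  then show "x s \<le> N + K * l" using N l_nonneg by (auto intro: add_increasing2)
  fix t assume t: "t \<in> T" "s \<le> t" "t < b" "x (\<alpha> t) < 0"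
  \<comment> \<open>The equation holds only from \<open>s\<close> on, so the increment is measured
    from \<open>s\<close> if \<open>\<alpha> t\<close> is earlier. Then \<open>x u \<le> N\<close>
    either by the initial value or because \<open>x (\<alpha> t)\<close> is negative.\<close>
  define u where "u = max s (\<alpha> t)"
  have u: "u \<in> T" "s \<le> u" "u \<le> t" "\<alpha> t \<le> u" "x u \<le> N"
    using \<alpha>_in[of t] \<alpha>_le[of t] s t N by (auto simp: u_def max_def)
  have j: "fwd_jump T t \<in> T" "t \<le> fwd_jump T t" "fwd_jump T t \<le> b"
    using fwd_jump_in closed_T t fwd_jump_ge fwd_jump_le b by auto
  have "x (fwd_jump T t) - x u \<le> K * (F (fwd_jump T t) - F u)"
  proof (rule solution_increment_le[OF x s(1)])
    fix r assume r: "r \<in> T" "u \<le> r" "r < fwd_jump T t"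
    show "- x (\<alpha> r) \<le> K"
    proof (cases "\<alpha> r < s")
      case True
      then show ?thesis using hist[of r] r u N by force
    next
      case False
      then show ?thesis using K[of "\<alpha> r"] \<alpha>_in[of r] \<alpha>_le[of r] r u j s by force
    qed
  qed (use u j in auto)
  also have "\<dots> \<le> K * l"
    using window[of t u] t u s K0 by (intro mult_left_mono) auto
  finally show "x (fwd_jump T t) \<le> N + K * l" using u by simp
qed

lemma solution_bounded_on_compact:
  assumes "solves s x"
  obtains B where "\<And>r. r \<in> T \<Longrightarrow> s \<le> r \<Longrightarrow> r \<le> b \<Longrightarrow> \<bar>x r\<bar> \<le> B"
proof -
  have "continuous_on (T \<inter> {s..} \<inter> {s..b}) x"
    by (rule delta_differentiable_continuous_on) (use assms in \<open>auto simp: solves_def\<close>)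
  moreover have "compact (T \<inter> {s..} \<inter> {s..b})"
    using closed_T by (intro closed_Int_compact closed_Int) auto
  ultimately have "bounded (x ` (T \<inter> {s..} \<inter> {s..b}))"
    using compact_continuous_image compact_imp_bounded by blast
  then obtain B where "\<forall>y\<in>x ` (T \<inter> {s..} \<inter> {s..b}). norm y \<le> B" unfolding bounded_iff by blast
  then show ?thesis using that[of B] by auto
qed

text \<open>The preceding bound for \<open>x\<close> and \<open>- x\<close>, with \<open>K'\<close>
  built from the finite maximum of the solution up to \<open>b\<close>, gives
  \<open>K' \<le> N + K' * l\<close>, which can be solved for \<open>K'\<close> since
  \<open>l < 1\<close>. The result does not depend on \<open>b\<close>.\<close>

lemma solution_stable:
  assumes x: "solves s x" and s: "t0 \<le> s" "s \<in> T" and b: "b \<in> T" "s \<le> b"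
    and hist: "\<And>t. t \<in> T \<Longrightarrow> s \<le> t \<Longrightarrow> \<alpha> t < s \<Longrightarrow> \<bar>x (\<alpha> t)\<bar> \<le> N"
    and N: "\<bar>x s\<bar> \<le> N"
  shows "\<bar>x b\<bar> \<le> N / (1 - l)"
proof -
  obtain B where B: "\<And>r. r \<in> T \<Longrightarrow> s \<le> r \<Longrightarrow> r \<le> b \<Longrightarrow> \<bar>x r\<bar> \<le> B"
    using solution_bounded_on_compact[OF x] by blast
  let ?R = "(\<lambda>r. \<bar>x r\<bar>) ` (T \<inter> {s..b})"
  define K where "K = Sup ?R"
  have "bdd_above ?R" using B by (intro bdd_aboveI[of _ B]) auto
  then have K: "\<bar>x r\<bar> \<le> K" if "r \<in> T" "s \<le> r" "r \<le> b" for r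
    unfolding K_def using that by (intro cSup_upper) auto
  define K' where "K' = max N K"
  have K': "N \<le> K'" "\<And>r. r \<in> T \<Longrightarrow> s \<le> r \<Longrightarrow> r \<le> b \<Longrightarrow> \<bar>x r\<bar> \<le> K'"
    using K by (auto simp: K'_def le_max_iff_disj)
  have "\<bar>x r\<bar> \<le> N + K' * l" if r: "r \<in> T" "s \<le> r" "r \<le> b" for r
  proof -
    have "x r \<le> N + K' * l"
      by (rule solution_upper_bound[OF x s r(1,2)]) (use hist N K' r in auto)
    moreover have "- x r \<le> N + K' * l"
      by (rule solution_upper_bound[OF solves_uminus[OF x] s r(1,2)]) (use hist N K' r in auto)
    ultimately show ?thesis by simp
  qed
  then have "K \<le> N + K' * l" unfolding K_def using s b by (intro cSup_least) auto
  moreover have "N \<le> N + K' * l"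
    using N K' l_nonneg by (simp add: order_trans[of 0 N K'])
  ultimately have "K' \<le> N + K' * l" by (simp add: K'_def)
  then have "K' * (1 - l) \<le> N" by (simp add: algebra_simps)
  then have "K' \<le> N / (1 - l)" using l_less_1 by (simp add: field_simps)
  then show ?thesis using K'(2)[OF b(1,2)] by simp
qed

section \<open>Attraction to zero\<close>

text \<open>Restart at a time \<open>a\<close> after which all delayed arguments are at least
  \<open>s\<close>: the history is then a piece of the solution on a compact interval, and no bound
  on the original history enters.\<close>

lemma solution_eventually_bounded:
  assumes x: "solves s x" and s: "t0 \<le> s" "s \<in> T"
  obtains a K where "a \<in> T" "s \<le> a" "\<And>t. t \<in> T \<Longrightarrow> a \<le> t \<Longrightarrow> \<bar>x t\<bar> \<le> K"
proof -
  obtain a where a: "a \<in> T" "s \<le> a" "\<forall>t\<in>T. a \<le> t \<longrightarrow> s \<le> \<alpha> t" using \<alpha>_unbounded by blast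
  obtain B where B: "\<And>r. r \<in> T \<Longrightarrow> s \<le> r \<Longrightarrow> r \<le> a \<Longrightarrow> \<bar>x r\<bar> \<le> B"
    using solution_bounded_on_compact[OF x] by blast
  have "\<bar>x t\<bar> \<le> B / (1 - l)" if "t \<in> T" "a \<le> t" for t
    by (rule solution_stable[OF solves_later[OF x a(2)] _ a(1) that])
      (use a s B \<alpha>_in in auto)
  then show ?thesis using that[OF a(1,2)] by blast
qed

text \<open>Once \<open>x \<circ> \<alpha>\<close> is negative at a late time \<open>t\<close>, the value at \<open>\<sigma>(t)\<close> exceeds the
  negative value at \<open>\<alpha>(t)\<close> by at most \<open>K * l\<close>; afterwards \<open>x\<close> can only grow where this
  bound is again in force.\<close>

lemma solution_contraction:
  assumes x: "solves s x" and s: "t0 \<le> s"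
    and K: "\<exists>a\<in>T. s \<le> a \<and> (\<forall>t\<in>T. a \<le> t \<longrightarrow> \<bar>x t\<bar> \<le> K)"
    and osc: "\<And>N. \<exists>t\<in>T. N \<le> t \<and> x (\<alpha> t) < 0"
  shows "\<exists>a\<in>T. s \<le> a \<and> (\<forall>t\<in>T. a \<le> t \<longrightarrow> x t \<le> K * l)"
proof -
  obtain a where a: "a \<in> T" "s \<le> a" "\<forall>t\<in>T. a \<le> t \<longrightarrow> \<bar>x t\<bar> \<le> K" using K by blast
  \<comment> \<open>Two steps back are needed: the increment runs from \<open>\<alpha> t\<close>,
    which must be past \<open>a1\<close>, and involves \<open>\<alpha> r\<close> for later
    \<open>r\<close>, which must be past \<open>a\<close>.\<close>
  obtain a1 where a1: "a1 \<in> T" "a \<le> a1" "\<forall>t\<in>T. a1 \<le> t \<longrightarrow> a \<le> \<alpha> t"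
    using \<alpha>_unbounded by blast
  obtain a2 where a2: "a2 \<in> T" "a1 \<le> a2" "\<forall>t\<in>T. a2 \<le> t \<longrightarrow> a1 \<le> \<alpha> t"
    using \<alpha>_unbounded by blast
  have K0: "0 \<le> K" using a by force
  have jump: "x (fwd_jump T t) \<le> K * l" if t: "t \<in> T" "a2 \<le> t" "x (\<alpha> t) < 0" for t
  proof -
    have \<alpha>: "\<alpha> t \<in> T" "\<alpha> t \<le> t" "a1 \<le> \<alpha> t"
      using \<alpha>_in \<alpha>_le t a a1 a2 s by auto
    have "x (fwd_jump T t) - x (\<alpha> t) \<le> K * (F (fwd_jump T t) - F (\<alpha> t))"
    proof (rule solution_increment_le[OF x s])
      fix r assume r: "r \<in> T" "\<alpha> t \<le> r"
      then have "\<alpha> r \<in> T" "a \<le> \<alpha> r" using \<alpha>_in[of r] \<alpha> a a1 s by auto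
      then show "- x (\<alpha> r) \<le> K" using a(3) by force
    qed (use \<alpha> a a1 t fwd_jump_in[OF closed_T t(1)] fwd_jump_ge[of t T] in auto)
    also have "\<dots> \<le> K * l"
      using window[of t "\<alpha> t"] t \<alpha> a a1 s K0 by (intro mult_left_mono) auto
    finally show ?thesis using t by simp
  qed
  obtain c where c: "c \<in> T" "a2 \<le> c" "x (\<alpha> c) < 0" using osc by blast
  let ?b = "fwd_jump T c"
  have b: "?b \<in> T" "a2 \<le> ?b" using fwd_jump_in[OF closed_T c(1)] fwd_jump_ge[of c T] c by auto
  have "x t \<le> K * l" if "t \<in> T" "?b \<le> t" for t
    by (rule solution_barrier[OF x s _ b(1) that jump[OF c]])
      (use jump b a a1 a2 in auto)
  then show ?thesis using b a a1 a2 by (intro bexI[of _ ?b]) auto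
qed

text \<open>Here \<open>x\<close> is eventually nonincreasing, and \<open>A\<close> not being integrable excludes a
  positive limit.\<close>

lemma solution_nonoscillatory:
  assumes x: "solves s x" and s: "t0 \<le> s"
    and nonneg: "\<And>t. t \<in> T \<Longrightarrow> M \<le> t \<Longrightarrow> 0 \<le> x (\<alpha> t)" and e: "0 < e"
  shows "\<exists>a\<in>T. s \<le> a \<and> (\<forall>t\<in>T. a \<le> t \<longrightarrow> \<bar>x t\<bar> \<le> e)"
proof -
  obtain a where a: "a \<in> T" "max s M \<le> a" using \<alpha>_unbounded by blast
  have decr: "x v \<le> x u" if "u \<in> T" "v \<in> T" "a \<le> u" "u \<le> v" for u v
    using solution_increment_le[OF x s _ that(1,2,4), of 0] nonneg that a by auto
  have pos: "0 \<le> x t" if t: "t \<in> T" "a \<le> t" for t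
  proof -
    \<comment> \<open>A later value \<open>x (\<alpha> b)\<close>, nonnegative by assumption, bounds
      \<open>x t\<close> from below.\<close>
    obtain b where b: "b \<in> T" "t \<le> b" "t \<le> \<alpha> b" using \<alpha>_unbounded by blast
    then have "x (\<alpha> b) \<le> x t" using decr t \<alpha>_in a s by auto
    then show ?thesis using nonneg[of b] b t a by auto
  qed
  have "\<exists>b\<in>T. a \<le> b \<and> x b \<le> e"
  proof (rule ccontr)
    assume "\<not> ?thesis"
    then have big: "e < x t" if "t \<in> T" "a \<le> t" for t using that by force
    obtain b where b: "b \<in> T" "a \<le> b" "\<forall>t\<in>T. b \<le> t \<longrightarrow> a \<le> \<alpha> t" using \<alpha>_unbounded by blast
    \<comment> \<open>While \<open>x \<circ> \<alpha>\<close> exceeds \<open>e\<close>,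
      \<open>x\<close> falls by at least \<open>e\<close> times the growth of \<open>F\<close>;
      growth by \<open>x b / e\<close> brings it down to 0.\<close>
    obtain c where c: "c \<in> T" "\<forall>t\<in>T. c \<le> t \<longrightarrow> F b + x b / e \<le> F t"
      using F_unbounded by blast
    define d where "d = max b c"
    have d: "d \<in> T" "b \<le> d" "F b + x b / e \<le> F d" using b c by (auto simp: d_def max_def)
    have "x d - x b \<le> - e * (F d - F b)"
    proof (rule solution_increment_le[OF x s _ b(1) d(1,2)])
      fix t assume "t \<in> T" "b \<le> t"
      then have "e < x (\<alpha> t)" using b a s \<alpha>_in by (intro big) auto
      then show "- x (\<alpha> t) \<le> - e" by simp
    qed (use a b in auto)
    moreover have "e * (x b / e) \<le> e * (F d - F b)" using d e by (intro mult_left_mono) auto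
    ultimately have "x d \<le> 0" using e by simp
    then show False using big[of d] d b e by simp
  qed
  then obtain b where b: "b \<in> T" "a \<le> b" "x b \<le> e" by blast
  then have "\<forall>t\<in>T. b \<le> t \<longrightarrow> \<bar>x t\<bar> \<le> e" using decr[of b] pos by force
  then show ?thesis using a b by (intro bexI[of _ b]) auto
qed

text \<open>Either \<open>x \<circ> \<alpha>\<close> eventually keeps a weak sign, or it takes both
  strict signs arbitrarily late; then contraction applies to \<open>x\<close> and \<open>- x\<close>
  at every step and gives bounds \<open>K * l ^ n\<close>.\<close>

lemma solution_attracted:
  assumes x: "solves s x" and s: "t0 \<le> s" "s \<in> T" and e: "0 < e"
  shows "\<exists>a\<in>T. s \<le> a \<and> (\<forall>t\<in>T. a \<le> t \<longrightarrow> \<bar>x t\<bar> \<le> e)"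
proof -
  consider (pos) M where "\<And>t. t \<in> T \<Longrightarrow> M \<le> t \<Longrightarrow> 0 \<le> x (\<alpha> t)"
    | (neg) M where "\<And>t. t \<in> T \<Longrightarrow> M \<le> t \<Longrightarrow> 0 \<le> - x (\<alpha> t)"
    | (osc) "\<And>N. \<exists>t\<in>T. N \<le> t \<and> x (\<alpha> t) < 0" "\<And>N. \<exists>t\<in>T. N \<le> t \<and> - x (\<alpha> t) < 0"
    by (meson not_le)
  then show ?thesis
  proof cases
    case pos
    then show ?thesis using solution_nonoscillatory[OF x s(1) _ e] by blast
  next
    case neg
    then show ?thesis using solution_nonoscillatory[OF solves_uminus[OF x] s(1) neg e] by simp
  next
    case osc
    obtain a K where K: "a \<in> T" "s \<le> a" "\<And>t. t \<in> T \<Longrightarrow> a \<le> t \<Longrightarrow> \<bar>x t\<bar> \<le> K"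
      using solution_eventually_bounded[OF x s] by blast
    have iter: "\<exists>a\<in>T. s \<le> a \<and> (\<forall>t\<in>T. a \<le> t \<longrightarrow> \<bar>x t\<bar> \<le> K * l ^ n)" for n
    proof (induction n)
      case 0
      then show ?case using K by auto
    next
      case (Suc n)
      obtain a where a: "a \<in> T" "s \<le> a" "\<forall>t\<in>T. a \<le> t \<longrightarrow> x t \<le> K * l ^ n * l"
        using solution_contraction[OF x s(1) Suc osc(1)] by blast
      have "\<exists>a\<in>T. s \<le> a \<and> (\<forall>t\<in>T. a \<le> t \<longrightarrow> \<bar>- x t\<bar> \<le> K * l ^ n)" using Suc by simp
      then obtain b where b: "b \<in> T" "s \<le> b" "\<forall>t\<in>T. b \<le> t \<longrightarrow> - x t \<le> K * l ^ n * l"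
        using solution_contraction[OF solves_uminus[OF x] s(1) _ osc(2)] by blast
      show ?case
        using a b by (intro bexI[of _ "max a b"]) (auto simp: max_def abs_le_iff algebra_simps)
    qed
    have "(\<lambda>n. K * l ^ n) \<longlonglongrightarrow> K * 0"
      using l_nonneg l_less_1 by (intro tendsto_mult tendsto_const LIMSEQ_power_zero) auto
    then obtain n where "K * l ^ n < e"
      using order_tendstoD(2)[of _ _ _ e] e eventually_sequentially by fastforce
    then show ?thesis using iter[of n] by force
  qed
qed

end

section \<open>Global asymptotic stability\<close>

lemma eventually_at_top_in:
  "eventually P (at_top_in T) \<longleftrightarrow> (\<exists>N. \<forall>t\<in>T. N \<le> t \<longrightarrow> P t)"
  unfolding at_top_in_def eventually_inf_principal eventually_at_top_linorder by blast

lemma delay_star_le: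
  assumes "bdd_below (\<alpha> ` (T \<inter> {t0..}))" "r \<in> T" "t0 \<le> r" "t \<le> r"
  shows "delay_star T \<alpha> t0 t \<le> \<alpha> r"
  unfolding delay_star_def using assms
  by (intro cInf_lower bdd_below_mono[OF assms(1)]) auto

text \<open>The lower limit of the window integral must be a point of \<open>T\<close>, since
  monotonicity of \<open>F\<close> is known only there.\<close>

lemma delay_star_in:
  assumes "closed T" "\<forall>t \<in> T \<inter> {t0..}. \<alpha> t \<in> T" "bdd_below (\<alpha> ` (T \<inter> {t0..}))"
    and "t \<in> T" "t0 \<le> t"
  shows "delay_star T \<alpha> t0 t \<in> T"
proof -
  let ?V = "\<alpha> ` (T \<inter> {t0..} \<inter> {t..})"
  have "?V \<noteq> {}" "bdd_below ?V" using assms by (auto intro: bdd_below_mono[OF assms(3)])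
  then have "Inf ?V \<in> closure ?V" by (rule closure_contains_Inf)
  also have "\<dots> \<subseteq> T" using assms(1,2) by (intro closure_minimal) auto
  finally show ?thesis unfolding delay_star_def .
qed

text \<open>Late values of \<open>\<alpha>\<close> are nonnegative and the earlier ones are bounded
  by rd-continuity. Hence the infimum in \<open>delay_star\<close> is a genuine one.\<close>

lemma delay_bdd_below:
  assumes "closed T" "rd_continuous_on (T \<inter> {t0..}) \<alpha>" "filterlim \<alpha> at_top (at_top_in T)"
  shows "bdd_below (\<alpha> ` (T \<inter> {t0..}))"
proof -
  obtain N where N: "\<forall>t\<in>T. N \<le> t \<longrightarrow> 0 \<le> \<alpha> t"
    using assms(3) unfolding filterlim_at_top eventually_at_top_in by blast
  have "closed (T \<inter> {t0..})" using assms(1) by (intro closed_Int) auto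
  from rd_continuous_bounded[OF this assms(2)]
  obtain B where B: "\<And>t. t \<in> T \<inter> {t0..} \<Longrightarrow> t0 \<le> t \<Longrightarrow> t \<le> N \<Longrightarrow> \<bar>\<alpha> t\<bar> \<le> B" by blast
  have "min 0 (- B) \<le> \<alpha> t" if "t \<in> T \<inter> {t0..}" for t
    using B[OF that] N that by (cases "t \<le> N") (auto simp: min_le_iff_disj)
  then show ?thesis by (intro bdd_belowI2)
qed

theorem theorem3p5:
  fixes T :: "real set" and t0 :: real and A \<alpha> :: "real \<Rightarrow> real"
  assumes "time_scale T"
    and "\<not> bdd_above T"
    and "t0 \<in> T"
    and "\<forall>t \<in> T \<inter> {t0..}. 0 \<le> A t"
    and "rd_continuous_on (T \<inter> {t0..}) A"
    and "\<forall>t \<in> T \<inter> {t0..}. \<alpha> t \<in> T"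
    and "rd_continuous_on (T \<inter> {t0..}) \<alpha>"
    and "filterlim \<alpha> at_top (at_top_in T)"
    and "\<forall>t \<in> T \<inter> {t0..}. \<alpha> t \<le> t"
    and "(SUP s \<in> T \<inter> {t0..}.
            ereal (delta_integral (T \<inter> {t0..}) A s (delay_inv T \<alpha> t0 s))) < \<infinity>"
    and "(SUP t \<in> T \<inter> {t0..}. ereal (delay_integral T A \<alpha> t0 t)) < 1"
    and "filterlim (\<lambda>t. delta_integral (T \<inter> {t0..}) A t0 t) at_top (at_top_in T)"
  shows "globally_asymptotically_stable T A \<alpha> t0"
proof -
  let ?S = "T \<inter> {t0..}"
  have T: "closed T" using assms(1) by (simp add: time_scale_def)
  then have S: "closed ?S" by (intro closed_Int) auto
  have unbdd: "\<exists>r\<in>T. N < r" for N using assms(2) by (meson bdd_aboveI not_le)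
  have "\<not> bdd_above ?S"
  proof
    assume "bdd_above ?S"
    then obtain M where "\<forall>t\<in>?S. t \<le> M" by (auto simp: bdd_above_def)
    then show False using unbdd[of "max M t0"] by force
  qed
  then have ex: "\<exists>F. delta_antideriv ?S A F"
    using rd_continuous_imp_antideriv[OF S, of t0 A] assms(3,5) by auto
  \<comment> \<open>The very antiderivative chosen inside \<open>delta_integral\<close>, so
    integrals become increments of \<open>F\<close> by unfolding.\<close>
  define F where "F = (SOME F. delta_antideriv ?S A F)"
  have F: "delta_antideriv ?S A F" unfolding F_def using ex by (rule someI_ex)
  have int: "delta_integral ?S A u v = F v - F u" for u v
    by (simp add: delta_integral_def F_def Let_def)
  have F_mono: "F u \<le> F v" if "u \<in> ?S" "v \<in> ?S" "u \<le> v" for u v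
    using delta_deriv_comparison[OF S that, of "\<lambda>_. 0" "\<lambda>_. 0" F A 1] F assms(4)
    by (auto simp: delta_antideriv_def has_delta_deriv_def intro: exI[of _ 1])
  have bdd: "bdd_below (\<alpha> ` ?S)" by (rule delay_bdd_below[OF T assms(7,8)])
  \<comment> \<open>A real number strictly between the supremum and 1 serves as a uniform window
    bound.\<close>
  obtain l where l: "(SUP t \<in> ?S. ereal (delay_integral T A \<alpha> t0 t)) < ereal l" "l < 1"
    using ereal_dense2[OF assms(11)] by (auto simp: one_ereal_def)
  have window: "F (fwd_jump T t) - F u \<le> l"
    if t: "t \<in> T" "t0 \<le> t" "u \<in> T" "t0 \<le> u" "\<alpha> t \<le> u" for t u
  proof -
    let ?m = "max t0 (delay_star T \<alpha> t0 t)"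
    have "?m \<in> ?S" using delay_star_in[OF T assms(6) bdd t(1,2)] assms(3) by (auto simp: max_def)
    moreover have "?m \<le> u" using delay_star_le[OF bdd t(1,2) order_refl] t by simp
    ultimately have "F ?m \<le> F u" using F_mono t by auto
    moreover have "ereal (F (fwd_jump T t) - F ?m) < ereal l"
      using le_less_trans[OF SUP_upper l(1), of t] t by (simp add: delay_integral_def int)
    ultimately show ?thesis by simp
  qed
  \<comment> \<open>Nonnegativity of \<open>l\<close> comes from the window at \<open>t0\<close>,
    which contains the nonnegative increment across the jump.\<close>
  have "0 \<le> F (fwd_jump T t0) - F t0"
    using F_mono[of t0 "fwd_jump T t0"] fwd_jump_ge[of t0 T] fwd_jump_in[OF T assms(3)] assms(3)
    by simp
  also have "\<dots> \<le> l" using window[of t0 t0] assms(3,9) by simp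
  finally have l0: "0 \<le> l" .
  have late: "\<exists>a\<in>T. N \<le> a \<and> (\<forall>t\<in>T. a \<le> t \<longrightarrow> P t)" if "eventually P (at_top_in T)" for N P
  proof -
    from that obtain M where M: "\<forall>t\<in>T. M \<le> t \<longrightarrow> P t" unfolding eventually_at_top_in by blast
    obtain a where "a \<in> T" "max N M < a" using unbdd by blast
    with M show ?thesis by (intro bexI[of _ a]) auto
  qed
  interpret delay_dynamic T t0 A \<alpha> F l
  proof
    show "\<exists>a\<in>T. N \<le> a \<and> (\<forall>t\<in>T. a \<le> t \<longrightarrow> N \<le> \<alpha> t)" for N
      using late assms(8) unfolding filterlim_at_top by blast
    show "\<exists>a\<in>T. \<forall>t\<in>T. a \<le> t \<longrightarrow> N \<le> F t" for N
    proof -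
      have "eventually (\<lambda>t. N - F t0 \<le> F t - F t0) (at_top_in T)"
        using assms(12) unfolding filterlim_at_top int by blast
      from late[OF this] show ?thesis by auto
    qed
  qed (use T assms(3,4,6,9) F l(2) l0 window in auto)
  have solves: "solves s x" if "is_solution T A \<alpha> t0 s x0 \<phi> x" for s x0 \<phi> x
  proof -
    obtain x' where x': "\<forall>t \<in> T \<inter> {s..}. has_delta_deriv (T \<inter> {s..}) x (x' t) t \<and>
        x' t + A t * x (\<alpha> t) = 0"
      using \<open>is_solution T A \<alpha> t0 s x0 \<phi> x\<close> unfolding is_solution_def by blast
    then have "x' t = - (A t * x (\<alpha> t))" if "t \<in> T \<inter> {s..}" for t
      using that by (simp add: eq_neg_iff_add_eq_0)
    with x' show ?thesis unfolding solves_def by metis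
  qed
  have "uniformly_stable T A \<alpha> t0"
    unfolding uniformly_stable_def
  proof (intro allI impI)
    fix \<epsilon> :: real assume \<epsilon>: "0 < \<epsilon>"
    show "\<exists>\<delta>>0. \<forall>s \<in> ?S. \<forall>x0 \<phi> x. is_solution T A \<alpha> t0 s x0 \<phi> x \<longrightarrow>
        ereal \<bar>x0\<bar> + max 0 (SUP \<eta>\<in>T \<inter> {delay_star T \<alpha> t0 s..<s}. ereal \<bar>\<phi> \<eta>\<bar>) < ereal \<delta> \<longrightarrow>
        (\<forall>t \<in> T \<inter> {s..}. \<bar>x t\<bar> < \<epsilon>)"
    \<comment> \<open>This choice inverts the factor \<open>1 / (1 - l)\<close> of the stability
      estimate.\<close>
    proof (intro exI[of _ "\<epsilon> * (1 - l)"] conjI ballI allI impI)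
      show "0 < \<epsilon> * (1 - l)" using \<epsilon> l(2) by simp
      fix s x0 \<phi> x t
      assume s: "s \<in> ?S" and sol: "is_solution T A \<alpha> t0 s x0 \<phi> x"
        and small: "ereal \<bar>x0\<bar> + max 0 (SUP \<eta>\<in>T \<inter> {delay_star T \<alpha> t0 s..<s}. ereal \<bar>\<phi> \<eta>\<bar>)
          < ereal (\<epsilon> * (1 - l))"
        and t: "t \<in> T \<inter> {s..}"
      let ?H = "SUP \<eta>\<in>T \<inter> {delay_star T \<alpha> t0 s..<s}. ereal \<bar>\<phi> \<eta>\<bar>"
      \<comment> \<open>A real \<open>N\<close> strictly in between bounds both data terms and keeps
        the final inequality strict.\<close>
      obtain N where N: "ereal \<bar>x0\<bar> + max 0 ?H < ereal N" "N < \<epsilon> * (1 - l)"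
        using ereal_dense2[OF small] by auto
      have "ereal \<bar>x0\<bar> + 0 \<le> ereal \<bar>x0\<bar> + max 0 ?H" by (intro add_left_mono) simp
      then have "ereal \<bar>x0\<bar> < ereal N" using N(1) by (simp del: ereal_less_eq less_ereal.simps)
      then have x0: "\<bar>x s\<bar> \<le> N" using sol by (simp add: is_solution_def)
      have hist: "\<bar>x (\<alpha> r)\<bar> \<le> N" if r: "r \<in> T" "s \<le> r" "\<alpha> r < s" for r
      proof -
        have \<alpha>r: "\<alpha> r \<in> T \<inter> {delay_star T \<alpha> t0 s..<s}"
          using delay_star_le[OF bdd r(1) _ r(2)] r s assms(6) by auto
        then have "ereal \<bar>\<phi> (\<alpha> r)\<bar> \<le> ?H" by (rule SUP_upper)
        also have "\<dots> \<le> 0 + max 0 ?H" by simp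
        also have "\<dots> \<le> ereal \<bar>x0\<bar> + max 0 ?H" by (intro add_right_mono) simp
        also note N(1)
        finally have "\<bar>\<phi> (\<alpha> r)\<bar> \<le> N" by simp
        then show ?thesis using sol \<alpha>r by (simp add: is_solution_def)
      qed
      have "\<bar>x t\<bar> \<le> N / (1 - l)"
        by (rule solution_stable[OF solves[OF sol]]) (use s t hist x0 in auto)
      also have "\<dots> < \<epsilon>" using N(2) l(2) by (simp add: field_simps)
      finally show "\<bar>x t\<bar> < \<epsilon>" .
    qed
  qed
  moreover have "globally_attracting T A \<alpha> t0"
    unfolding globally_attracting_def
  proof (intro ballI allI impI tendstoI)
    fix s x0 \<phi> x and e :: real
    assume s: "s \<in> ?S" and sol: "is_solution T A \<alpha> t0 s x0 \<phi> x" and e: "0 < e"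
    obtain a where "a \<in> T" "\<forall>t\<in>T. a \<le> t \<longrightarrow> \<bar>x t\<bar> \<le> e / 2"
      using solution_attracted[OF solves[OF sol], of "e / 2"] s e by auto
    then show "\<forall>\<^sub>F t in at_top_in T. dist (x t) 0 < e"
      unfolding eventually_at_top_in using e by (intro exI[of _ a]) (force simp: dist_real_def)
  qed
  ultimately show ?thesis by (simp add: globally_asymptotically_stable_def)
qed

end
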